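(* The following are equivalent: (i) the Continuum Hypothesis $\aleph_1 = 2^{\aleph_0}$ holds; (ii) there exists a subsemigroup $S$ of $\mathbb{N}^\mathbb{N}$ such that $S \approx \mathbb{N}^\mathbb{N}$ and for every subsemigroup $T$ of $S$, either $T \approx \mathbb{N}^\mathbb{N}$ or $T \approx \{1_{\mathbb{N}}\}$.
   Context: $\mathbb{N}=\{0,1,2,\ldots\}$ and $\mathbb{N}^\mathbb{N}$ is the semigroup of all maps $\mathbb{N}\to\mathbb{N}$ under composition; $1_{\mathbb{N}}$ is the identity map. For $V\subseteq \mathbb{N}^\mathbb{N}$ and $C\subseteq\mathbb{N}^\mathbb{N}$, $\langle V, C\rangle$ denotes the subsemigroup of $\mathbb{N}^\mathbb{N}$ generated by $V\cup C$. For subsets $U,V\subseteq\mathbb{N}^\mathbb{N}$, write $U\preccurlyeq V$ if there is a countable $C\subseteq \mathbb{N}^\mathbb{N}$ with $U\subseteq\langle V, C\rangle$; write $U\approx V$ if $U\preccurlyeq V$ and $V\preccurlyeq U$. *)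

theory Defs
  imports Complex_Main "HOL-Library.Countable_Set"
begin

unbundle cardinal_syntax

text \<open>\<open>cardSuc natLeq\<close> is $\aleph_1$ and \<open>ctwo ^c natLeq\<close> is $2^{\aleph_0}$.\<close>

definition continuum_hypothesis :: bool where
  "continuum_hypothesis \<longleftrightarrow> cardSuc natLeq =o ctwo ^c natLeq"

text \<open>The empty set is admitted as a subsemigroup.\<close>

definition subsemigroup :: "(nat \<Rightarrow> nat) set \<Rightarrow> bool" where
  "subsemigroup S \<longleftrightarrow> (\<forall>f\<in>S. \<forall>g\<in>S. f \<circ> g \<in> S)"

definition generated :: "(nat \<Rightarrow> nat) set \<Rightarrow> (nat \<Rightarrow> nat) set \<Rightarrow> (nat \<Rightarrow> nat) set" where
  "generated V C = subsemigroup hull (V \<union> C)"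

definition gen_le :: "(nat \<Rightarrow> nat) set \<Rightarrow> (nat \<Rightarrow> nat) set \<Rightarrow> bool"  (infix \<open>\<preceq>\<^sub>\<omega>\<close> 50) where
  "U \<preceq>\<^sub>\<omega> V \<longleftrightarrow> (\<exists>C. countable C \<and> U \<subseteq> generated V C)"

definition gen_equiv :: "(nat \<Rightarrow> nat) set \<Rightarrow> (nat \<Rightarrow> nat) set \<Rightarrow> bool"  (infix \<open>\<approx>\<^sub>\<omega>\<close> 50) where
  "U \<approx>\<^sub>\<omega> V \<longleftrightarrow> U \<preceq>\<^sub>\<omega> V \<and> V \<preceq>\<^sub>\<omega> U"

end

theory Submission
  imports Defs "HOL-Library.Nat_Bijection"
begin

text \<open>
  A set is \<open>\<approx>\<^sub>\<omega> {id}\<close> exactly when it is countable. Given \<open>S\<close> as in (ii), a subset of \<open>S\<close> of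
  size \<open>\<aleph>\<^sub>1\<close> generates a subsemigroup of size \<open>\<aleph>\<^sub>1\<close>, which must then generate all maps modulo a
  countable set; hence the continuum is at most \<open>\<aleph>\<^sub>1\<close>.

  Conversely, CH well-orders the maps in such a way that every initial segment is countable.
  Let \<open>h\<^sub>f\<close> send even numbers to \<open>0\<close> and encode on the odd numbers, with even values, all maps
  up to \<open>f\<close>. The product of any two of these maps is the zero map, so that
  \<open>S = {h\<^sub>f | f} \<union> {0}\<close> is a semigroup. An uncountable subset of \<open>S\<close> contains \<open>h\<^sub>f\<close> for
  cofinally many \<open>f\<close>, and every map up to \<open>f\<close> is recovered from \<open>h\<^sub>f\<close> by countably many fixed
  decoding maps.
\<close>

lemma countable_iff_card_of_ordLeq_natLeq: "countable A \<longleftrightarrow> |A| \<le>o natLeq"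
proof -
  have "countable A \<longleftrightarrow> |A| \<le>o |UNIV :: nat set|"
    unfolding countable_def card_of_ordLeq[symmetric] by auto
  also have "\<dots> \<longleftrightarrow> |A| \<le>o natLeq"
    using card_of_nat ordIso_symmetric ordLeq_ordIso_trans by blast
  finally show ?thesis .
qed

text \<open>Raising the base from 2 to \<aleph>\<open>\<^sub>0\<close> does not enlarge the power:
  it is bounded by a power of a power, whose two exponents multiply to
  \<aleph>\<open>\<^sub>0\<close> again.\<close>

lemma card_of_nat_fun: "|UNIV :: (nat \<Rightarrow> nat) set| =o ctwo ^c natLeq"
proof -
  have "|UNIV :: (nat \<Rightarrow> nat) set| =o |Func (UNIV :: nat set) (UNIV :: nat set)|"
    using card_of_Func_UNIV[of "UNIV :: nat set", where ?'a = nat] ordIso_symmetric by auto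
  also have "|Func (UNIV :: nat set) (UNIV :: nat set)| = natLeq ^c natLeq"
    unfolding cexp_def Field_natLeq ..
  finally have 1: "|UNIV :: (nat \<Rightarrow> nat) set| =o natLeq ^c natLeq" .
  have "natLeq ^c natLeq \<le>o (ctwo ^c natLeq) ^c natLeq"
    by (intro cexp_mono1 natLeq_Card_order ordLess_imp_ordLeq[OF ordLess_ctwo_cexp])
  moreover have "(ctwo ^c natLeq) ^c natLeq =o ctwo ^c natLeq"
    by (intro cexp_cprod_ordLeq Card_order_ctwo natLeq_Cinfinite Cinfinite_Cnotzero
        ordLeq_refl natLeq_Card_order)
  ultimately have 2: "natLeq ^c natLeq \<le>o ctwo ^c natLeq"
    by (rule ordLeq_ordIso_trans)
  have "ctwo ^c natLeq \<le>o natLeq ^c natLeq"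
    by (intro cexp_mono1 natLeq_Card_order ctwo_ordLeq_Cinfinite natLeq_Cinfinite)
  with 2 have "natLeq ^c natLeq =o ctwo ^c natLeq"
    by (simp add: ordIso_iff_ordLeq)
  with 1 show ?thesis by (rule ordIso_transitive)
qed

lemma subsemigroup_hull: "subsemigroup (subsemigroup hull A)"
  by (rule hull_in) (auto simp: subsemigroup_def)

lemma comp_in_generated: "f \<in> generated V C \<Longrightarrow> g \<in> generated V C \<Longrightarrow> f \<circ> g \<in> generated V C"
  using subsemigroup_hull unfolding generated_def subsemigroup_def by blast

lemma subset_generated: "V \<union> C \<subseteq> generated V C"
  unfolding generated_def by (rule hull_subset)

text \<open>Every element of the hull is a finite product over \<open>A\<close>. For each length,
  the set of products is an image of \<open>A\<close> times the set for the previous length, so its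
  cardinality stays within \<open>r\<close>, and there are only countably many lengths.\<close>

lemma card_of_subsemigroup_hull_ordLeq:
  assumes A: "|A| \<le>o r" and r: "Cinfinite r"
  shows "|subsemigroup hull A| \<le>o r"
proof -
  \<comment> \<open>\<open>W n\<close> is the set of products of \<open>n\<close> factors from
    \<open>A\<close>. The empty product \<open>id\<close> may lie outside the hull, which is
    harmless for an upper bound.\<close>
  define W where "W n = ((\<lambda>X. (\<lambda>(f, g). f \<circ> g) ` (A \<times> X)) ^^ n) {id}" for n
  have W_0: "W 0 = {id}" and W_Suc: "W (Suc n) = (\<lambda>(f, g). f \<circ> g) ` (A \<times> W n)" for n
    by (simp_all add: W_def)
  have card_W: "|W n| \<le>o r" for n
  proof (induction n)
    case 0
    show ?case
      using r natLeq_ordLeq_cinfinite ordLeq_transitive countable_iff_card_of_ordLeq_natLeq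
      by (metis W_0 countable_empty countable_insert)
  next
    case (Suc n)
    have "|A \<times> W n| \<le>o r"
      using A Suc r by (auto simp: cinfinite_def intro: card_of_Times_ordLeq_infinite_Field)
    then show ?case
      unfolding W_Suc using card_of_image ordLeq_transitive by blast
  qed
  have W_comp: "f \<circ> g \<in> W (m + n)" if "f \<in> W m" "g \<in> W n" for f g m n
    using that(1)
  proof (induction m arbitrary: f)
    case 0
    with that(2) show ?case by (simp add: W_0)
  next
    case (Suc m)
    then obtain a f' where "f = a \<circ> f'" "a \<in> A" "f' \<in> W m"
      by (auto simp: W_Suc)
    with Suc.IH[of f'] have "f \<circ> g = a \<circ> (f' \<circ> g)" "(a, f' \<circ> g) \<in> A \<times> W (m + n)"
      by (simp_all only: comp_assoc mem_Times_iff fst_conv snd_conv)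
    then show ?case
      unfolding add_Suc W_Suc by (intro image_eqI[of _ _ "(a, f' \<circ> g)"]) (simp_all only: case_prod_conv)
  qed
  have "A \<subseteq> W 1"
    by (force simp: W_Suc W_0)
  then have "A \<subseteq> (\<Union>n. W n)"
    by blast
  moreover have "subsemigroup (\<Union>n. W n)"
    unfolding subsemigroup_def using W_comp by (metis UN_iff UNIV_I)
  ultimately have "subsemigroup hull A \<subseteq> (\<Union>n. W n)"
    by (rule hull_minimal)
  moreover have "|UNIV :: nat set| \<le>o r"
    using card_of_nat natLeq_ordLeq_cinfinite[OF r] by (rule ordIso_ordLeq_trans)
  then have "|\<Union>n. W n| \<le>o r"
    using card_W r by (intro UNION_Cinfinite_bound ballI)
  ultimately show ?thesis
    using card_of_mono1 ordLeq_transitive by blast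
qed

lemma countable_generated: "countable V \<Longrightarrow> countable C \<Longrightarrow> countable (generated V C)"
  unfolding generated_def countable_iff_card_of_ordLeq_natLeq
  by (intro card_of_subsemigroup_hull_ordLeq Un_Cinfinite_bound natLeq_Cinfinite)

text \<open>Countably many maps generate only countably many; conversely, a countable set can itself
  be taken as the set of extra generators.\<close>

lemma gen_equiv_id_iff_countable: "T \<approx>\<^sub>\<omega> {id} \<longleftrightarrow> countable T"
proof
  assume "T \<approx>\<^sub>\<omega> {id}"
  then obtain C where "countable C" "T \<subseteq> generated {id} C"
    by (auto simp: gen_equiv_def gen_le_def)
  then show "countable T"
    using countable_generated[of "{id}" C] countable_subset by auto
next
  assume "countable T"
  then have "T \<preceq>\<^sub>\<omega> {id}"
    unfolding gen_le_def using subset_generated by blast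
  moreover have "{id} \<preceq>\<^sub>\<omega> T"
    unfolding gen_le_def using subset_generated[of T "{id}"] by (intro exI[of _ "{id}"]) auto
  ultimately show "T \<approx>\<^sub>\<omega> {id}"
    by (simp add: gen_equiv_def)
qed

text \<open>The other direction of the equivalence always holds, with no extra generators.\<close>

lemma gen_equiv_UNIV_iff: "T \<approx>\<^sub>\<omega> UNIV \<longleftrightarrow> UNIV \<preceq>\<^sub>\<omega> T"
  unfolding gen_equiv_def gen_le_def using subset_generated[of UNIV "{}"] by auto

lemma not_countable_nat_fun: "\<not> countable (UNIV :: (nat \<Rightarrow> nat) set)"
  unfolding countable_iff_card_of_ordLeq_natLeq
  using ordLess_ctwo_cexp[OF natLeq_Card_order] card_of_nat_fun
  by (meson not_ordLess_ordLeq ordIso_symmetric ordIso_ordLeq_trans)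

lemma continuum_hypothesis_if_dichotomy:
  assumes S: "subsemigroup S" "S \<approx>\<^sub>\<omega> UNIV"
    and dich: "\<And>T. T \<subseteq> S \<Longrightarrow> subsemigroup T \<Longrightarrow> T \<approx>\<^sub>\<omega> UNIV \<or> T \<approx>\<^sub>\<omega> {id}"
  shows continuum_hypothesis
proof -
  let ?aleph1 = "cardSuc natLeq"
  have Cinf: "Cinfinite ?aleph1"
    by (intro Cinfinite_cardSuc natLeq_Cinfinite)
  obtain C where "countable C" "UNIV \<subseteq> generated S C"
    using S(2) by (auto simp: gen_equiv_UNIV_iff gen_le_def)
  then have "\<not> countable S"
    using countable_generated not_countable_nat_fun countable_subset by blast
  then have "natLeq <o |S|"
    unfolding countable_iff_card_of_ordLeq_natLeq
    by (simp add: not_ordLeq_iff_ordLess[OF natLeq_Well_order card_of_Well_order])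
  then have "?aleph1 \<le>o |S|"
    by (simp only: cardSuc_ordLess_ordLeq[OF natLeq_Card_order card_of_Card_order])
  then have "|Field ?aleph1| \<le>o |S|"
    using card_of_Field_ordIso[OF conjunct2[OF Cinf]] ordIso_ordLeq_trans by blast
  then obtain A where "A \<subseteq> S" "|Field ?aleph1| =o |A|"
    using iffD1[OF internalize_card_of_ordLeq2] by blast
  then have A: "|A| =o ?aleph1"
    using card_of_Field_ordIso[OF conjunct2[OF Cinf]] ordIso_symmetric ordIso_transitive by blast
  define T where "T = subsemigroup hull A"
  have "T \<subseteq> S"
    unfolding T_def using \<open>A \<subseteq> S\<close> S(1) by (rule hull_minimal)
  have "\<not> countable A"
    unfolding countable_iff_card_of_ordLeq_natLeq
    using A cardSuc_greater[OF natLeq_Card_order]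
    by (meson not_ordLess_ordLeq ordIso_symmetric ordIso_ordLeq_trans)
  then have "\<not> countable T"
    unfolding T_def using countable_subset[OF hull_subset] by blast
  with dich[of T] have "UNIV \<preceq>\<^sub>\<omega> T"
    using \<open>T \<subseteq> S\<close> subsemigroup_hull
    by (auto simp: T_def gen_equiv_UNIV_iff gen_equiv_id_iff_countable)
  then obtain D where D: "countable D" "generated T D = UNIV"
    by (auto simp: gen_le_def)
  have "|D| \<le>o ?aleph1"
    using D(1) cardSuc_ordLeq[OF natLeq_Card_order] ordLeq_transitive
    unfolding countable_iff_card_of_ordLeq_natLeq by blast
  then have "|subsemigroup hull (A \<union> D)| \<le>o ?aleph1"
    using A Cinf ordIso_imp_ordLeq
    by (intro card_of_subsemigroup_hull_ordLeq Un_Cinfinite_bound)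
  \<comment> \<open>Generating from \<open>T\<close> and \<open>D\<close> is the same as generating
    from \<open>A\<close> and \<open>D\<close>, since the inner hull is absorbed; this moves the
    bound on \<open>A\<close> to the set of all maps.\<close>
  moreover have "subsemigroup hull (A \<union> D) = UNIV"
    using D(2) unfolding generated_def T_def by (simp flip: hull_Un_left)
  ultimately have "ctwo ^c natLeq \<le>o ?aleph1"
    using card_of_nat_fun ordIso_symmetric ordIso_ordLeq_trans by metis
  moreover have "?aleph1 \<le>o ctwo ^c natLeq"
    using ordLess_ctwo_cexp[OF natLeq_Card_order]
    by (simp only: cardSuc_ordLess_ordLeq[OF natLeq_Card_order Card_order_cexp])
  ultimately show ?thesis
    by (simp add: continuum_hypothesis_def ordIso_iff_ordLeq)
qed

text \<open>In a well-order of the maps whose type is a cardinal, CH makes every proper initial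
  segment countable. \<open>E f\<close> lists \<open>f\<close> and its predecessors, so it can miss
  \<open>g\<close> only if \<open>f\<close> precedes \<open>g\<close>.\<close>

lemma continuum_hypothesis_enumeration:
  assumes continuum_hypothesis
  obtains E :: "(nat \<Rightarrow> nat) \<Rightarrow> nat \<Rightarrow> nat \<Rightarrow> nat"
  where "\<And>f. f \<in> range (E f)" and "\<And>g. countable {f. g \<notin> range (E f)}"
proof -
  define r where "r = |UNIV :: (nat \<Rightarrow> nat) set|"
  have r: "Card_order r" "Field r = UNIV" "Well_order r"
    unfolding r_def by (rule card_of_Card_order Field_card_of card_of_Well_order)+
  have "r =o cardSuc natLeq"
    using assms card_of_nat_fun ordIso_symmetric ordIso_transitive
    unfolding continuum_hypothesis_def r_def by blast
  then have "|underS r f| <o cardSuc natLeq" for f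
    using card_of_underS[OF r(1), of f] r(2) ordLess_ordIso_trans by blast
  then have underS: "countable (underS r f)" for f
    unfolding countable_iff_card_of_ordLeq_natLeq
    by (simp only: cardSuc_ordLeq_ordLess[OF natLeq_Card_order card_of_Card_order])
  \<comment> \<open>Inserting \<open>f\<close> also keeps the set nonempty for the least
    \<open>f\<close>, as \<open>from_nat_into\<close> requires in order to have exactly this
    range.\<close>
  define E where "E f = from_nat_into (insert f (underS r f))" for f
  have range_E: "range (E f) = insert f (underS r f)" for f
    unfolding E_def using underS by (intro range_from_nat_into) auto
  have "{f. g \<notin> range (E f)} \<subseteq> underS r g" for g
  proof
    fix f assume "f \<in> {f. g \<notin> range (E f)}"
    then have "g \<noteq> f" "(g, f) \<notin> r"
      by (auto simp: range_E underS_def)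
    moreover have "Total r"
      using r(3) by (simp add: well_order_on_def linear_order_on_def)
    ultimately show "f \<in> underS r g"
      using r(2) by (auto simp: underS_def total_on_def)
  qed
  then show thesis
    using that[of E] underS countable_subset range_E by (metis insertI1)
qed

text \<open>The odd number \<open>2 * prod_encode (n, x) + 1\<close> carries the value
  \<open>e n x\<close>, doubled so that all values are even. Since even arguments go to 0, a second
  encoded map annihilates the first.\<close>

definition encode_seq :: "(nat \<Rightarrow> nat \<Rightarrow> nat) \<Rightarrow> nat \<Rightarrow> nat" where
  "encode_seq e k =
     (if even k then 0 else case prod_decode (k div 2) of (n, x) \<Rightarrow> 2 * e n x)"

lemma encode_seq_comp: "encode_seq e \<circ> encode_seq e' = (\<lambda>_. 0)"
  by (auto simp: encode_seq_def fun_eq_iff split: prod.split)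

lemma encode_seq_const_0:
  "encode_seq e \<circ> (\<lambda>_. 0) = (\<lambda>_. 0)" "(\<lambda>_. 0) \<circ> encode_seq e = (\<lambda>_. 0)"
  by (auto simp: encode_seq_def)

text \<open>The inner map selects the odd positions belonging to \<open>n\<close>, and halving
  undoes the doubling. Neither decoder depends on \<open>e\<close>.\<close>

lemma decode_encode_seq:
  "(\<lambda>k. k div 2) \<circ> (encode_seq e \<circ> (\<lambda>x. Suc (2 * prod_encode (n, x)))) = e n"
  by (auto simp: encode_seq_def fun_eq_iff)

text \<open>The decoders for all indices \<open>n\<close> form one countable set that serves every
  \<open>e\<close>, so each \<open>g\<close> may be read off from a different encoded sequence in
  \<open>T\<close>.\<close>

lemma UNIV_gen_le_if_encode_seq:
  assumes "\<And>g. \<exists>e. encode_seq e \<in> T \<and> g \<in> range e"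
  shows "UNIV \<preceq>\<^sub>\<omega> T"
proof -
  define C where "C = insert (\<lambda>k. k div 2) (range (\<lambda>n x. Suc (2 * prod_encode (n, x))))"
  have "g \<in> generated T C" for g
  proof -
    obtain e n where "encode_seq e \<in> T" "g = e n"
      using assms[of g] by blast
    moreover from this have "{encode_seq e, \<lambda>k. k div 2, \<lambda>x. Suc (2 * prod_encode (n, x))}
        \<subseteq> generated T C"
      using subset_generated[of T C] by (auto simp: C_def)
    ultimately show ?thesis
      using comp_in_generated decode_encode_seq[of e n] by (metis insert_subset)
  qed
  moreover have "countable C"
    by (simp add: C_def)
  ultimately show ?thesis
    unfolding gen_le_def by blast
qed

lemma dichotomy_if_continuum_hypothesis:
  assumes continuum_hypothesis
  shows "\<exists>S. subsemigroup S \<and> S \<approx>\<^sub>\<omega> UNIV \<and>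
    (\<forall>T. T \<subseteq> S \<and> subsemigroup T \<longrightarrow> T \<approx>\<^sub>\<omega> UNIV \<or> T \<approx>\<^sub>\<omega> {id})"
proof -
  obtain E :: "(nat \<Rightarrow> nat) \<Rightarrow> nat \<Rightarrow> nat \<Rightarrow> nat"
    where E: "\<And>f. f \<in> range (E f)" "\<And>g. countable {f. g \<notin> range (E f)}"
    using continuum_hypothesis_enumeration[OF assms] by blast
  define S where "S = insert (\<lambda>_. 0) (range (\<lambda>f. encode_seq (E f)))"
  have "subsemigroup S"
    by (auto simp: subsemigroup_def S_def encode_seq_comp encode_seq_const_0)
  moreover have "S \<approx>\<^sub>\<omega> UNIV"
    unfolding gen_equiv_UNIV_iff
  proof (rule UNIV_gen_le_if_encode_seq)
    show "\<exists>e. encode_seq e \<in> S \<and> g \<in> range e" for g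
      using E(1)[of g] by (intro exI[of _ "E g"]) (simp add: S_def)
  qed
  moreover have "T \<approx>\<^sub>\<omega> UNIV \<or> T \<approx>\<^sub>\<omega> {id}" if "T \<subseteq> S" for T
  proof (cases "countable T")
    case True
    then show ?thesis by (simp add: gen_equiv_id_iff_countable)
  next
    case False
    have "\<exists>e. encode_seq e \<in> T \<and> g \<in> range e" for g
    proof (rule ccontr)
      assume "\<nexists>e. encode_seq e \<in> T \<and> g \<in> range e"
      \<comment> \<open>A map \<open>g\<close> encoded nowhere in \<open>T\<close> confines
        \<open>T\<close> to the zero map and the codes of those \<open>f\<close> whose list misses
        \<open>g\<close>, which are countably many.\<close>
      then have "T \<subseteq> insert (\<lambda>_. 0) ((\<lambda>f. encode_seq (E f)) ` {f. g \<notin> range (E f)})"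
        using \<open>T \<subseteq> S\<close> unfolding S_def by blast
      moreover have "countable \<dots>"
        using E(2) by simp
      ultimately show False
        using False countable_subset by blast
    qed
    then show ?thesis
      by (simp add: gen_equiv_UNIV_iff UNIV_gen_le_if_encode_seq)
  qed
  ultimately show ?thesis by blast
qed

theorem theorem2p1:
  "continuum_hypothesis \<longleftrightarrow>
    (\<exists>S :: (nat \<Rightarrow> nat) set. subsemigroup S \<and> S \<approx>\<^sub>\<omega> UNIV \<and>
      (\<forall>T. T \<subseteq> S \<and> subsemigroup T \<longrightarrow> T \<approx>\<^sub>\<omega> UNIV \<or> T \<approx>\<^sub>\<omega> {id}))"
  (is "_ \<longleftrightarrow> ?rhs")
proof
  assume continuum_hypothesis
  then show ?rhs by (rule dichotomy_if_continuum_hypothesis)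
next
  assume ?rhs
  then show continuum_hypothesis
    by (elim exE conjE) (rule continuum_hypothesis_if_dichotomy, assumption+, blast)
qed

end
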